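(* Let $f:\mathbb{R}^n\to\mathbb{R}$ be convex and twice differentiable with Lipschitz continuous gradient and with $2L$-Lipschitz Hessian, $L>0$. For the iterates $\bm{x}^k$ of the Adaptive Inertial Method with inertial term $\bm{m}^k=\mathrm{H}_k\bm{g}^k$ (assumed nonzero), where $\bm{g}^k=\nabla f(\bm{x}^k)$ and $\mathrm{H}_k=\nabla^2 f(\bm{x}^k)$, put $$\theta_k=\sqrt{L\|\bm{g}^k\|},\qquad r_k=\frac{(\bm{g}^k)^\top\mathrm{H}_k^2\bm{g}^k}{(\bm{g}^k)^\top\mathrm{H}_k\bm{g}^k}.$$ Suppose that for each iteration $k$ there exists a scalar $a_k>0$ such that $\mathrm{H}_k^2=a_k\mathrm{H}_k$. If the parameters are selected as $$\beta_k=\frac{1}{\theta_k}\quad\text{and}\quad \mu_k=\frac{1}{1+\theta_k/r_k},$$ then the Adaptive Inertial Method is algebraically equivalent to the regularized Newton method when both are initialized at the same point; that is, at every $k$ the Adaptive Inertial Method update satisfies $$\bm{x}^{k+1}=\bm{x}^k-(\theta_k\mathrm{I}_n+\mathrm{H}_k)^{-1}\bm{g}^k,$$ so the two methods generate the same sequence of iterates.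
   Context: The Adaptive Inertial Method update with step size $\beta_k$, parameter $\mu_k\in[0,1)$ and nonzero inertial term $\bm{m}^k\in\mathbb{R}^n$ is $$\bm{x}^{k+1}=\bm{x}^k-\beta_k\nabla f(\bm{x}^k)+\gamma_k\bm{m}^k,\qquad \gamma_k=\mu_k\frac{(\bm{m}^k)^\top\nabla f(\bm{x}^k)}{\|\bm{m}^k\|^2}\beta_k.$$ With $\bm{m}^k=\mathrm{H}_k\bm{g}^k$ this is $\bm{x}^{k+1}=\bm{x}^k-\beta_k\big(\mathrm{I}_n-\frac{\mu_k}{r_k}\mathrm{H}_k\big)\bm{g}^k$. The step size and $\mu_k$ are here prescribed directly by the formulas in the statement. The regularized Newton method is the iteration $\bm{x}^{k+1}=\bm{x}^k-(\theta_k\mathrm{I}_n+\mathrm{H}_k)^{-1}\bm{g}^k$ with $\theta_k=\sqrt{L\|\bm{g}^k\|}$, $\bm{g}^k=\nabla f(\bm{x}^k)$, $\mathrm{H}_k=\nabla^2 f(\bm{x}^k)$, where the Hessian is $2L$-Lipschitz: $\|\nabla^2 f(\bm{x})-\nabla^2 f(\bm{y})\|\le 2L\|\bm{x}-\bm{y}\|$ for all $\bm{x},\bm{y}\in\mathbb{R}^n$. $\|\cdot\|$ is the Euclidean norm (operator norm for matrices) and $\mathrm{I}_n$ the identity matrix. *)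

theory Defs
  imports "HOL-Analysis.Analysis"
begin

definition grad :: "(real^'n \<Rightarrow> real) \<Rightarrow> real^'n \<Rightarrow> real^'n" where
  "grad f x = (THE d. GDERIV f x :> d)"

definition hess :: "(real^'n \<Rightarrow> real) \<Rightarrow> real^'n \<Rightarrow> real^'n^'n" where
  "hess f x = jacobian (grad f) (at x)"

definition twice_differentiable :: "(real^'n \<Rightarrow> real) \<Rightarrow> bool" where
  "twice_differentiable f \<longleftrightarrow>
     (\<forall>x. f differentiable (at x)) \<and> (\<forall>x. grad f differentiable (at x))"

(* Lipschitz continuity of the Hessian in the operator norm. The library norm on
   real^'n^'n is the Frobenius norm, so the operator norm is written with onorm. *)
definition hess_lipschitz :: "real \<Rightarrow> (real^'n \<Rightarrow> real) \<Rightarrow> bool" where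
  "hess_lipschitz C f \<longleftrightarrow>
     (\<forall>x y. onorm ((*v) (hess f x - hess f y)) \<le> C * norm (x - y))"

definition aim_step ::
    "(real^'n \<Rightarrow> real) \<Rightarrow> real \<Rightarrow> real \<Rightarrow> real^'n \<Rightarrow> real^'n \<Rightarrow> real^'n" where
  "aim_step f \<beta> \<mu> m x =
     (let \<gamma> = \<mu> * ((m \<bullet> grad f x) / (norm m)\<^sup>2) * \<beta>
      in x - \<beta> *\<^sub>R grad f x + \<gamma> *\<^sub>R m)"

(* The method's range condition 0 <= \<mu> k < 1 is not imposed. *)
definition aim_iterates ::
    "(real^'n \<Rightarrow> real) \<Rightarrow> (nat \<Rightarrow> real) \<Rightarrow> (nat \<Rightarrow> real) \<Rightarrow> (nat \<Rightarrow> real^'n) \<Rightarrow>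
     (nat \<Rightarrow> real^'n) \<Rightarrow> bool" where
  "aim_iterates f \<beta> \<mu> m x \<longleftrightarrow>
     (\<forall>k. m k \<noteq> 0 \<and> x (Suc k) = aim_step f (\<beta> k) (\<mu> k) (m k) (x k))"

definition reg_newton_matrix :: "real \<Rightarrow> (real^'n \<Rightarrow> real) \<Rightarrow> real^'n \<Rightarrow> real^'n^'n" where
  "reg_newton_matrix L f x = sqrt (L * norm (grad f x)) *\<^sub>R mat 1 + hess f x"

definition reg_newton_iterates ::
    "real \<Rightarrow> (real^'n \<Rightarrow> real) \<Rightarrow> (nat \<Rightarrow> real^'n) \<Rightarrow> bool" where
  "reg_newton_iterates L f y \<longleftrightarrow>
     (\<forall>k. y (Suc k) = y k - matrix_inv (reg_newton_matrix L f (y k)) *v grad f (y k))"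

end

theory Submission
  imports Defs
begin

text \<open>Since \<open>H k\<close> squares to \<open>a\<close> times itself, \<open>H k\<close>
  acts as multiplication by \<open>a\<close> on its own range, so the inverse of \<theta> I + H is a
  linear polynomial in H: (1/\<theta>) (I - H / (a + \<theta>)), by
  \<open>regularized_inverse_of_square_eq_scaleR\<close>. The inertial step has the same shape, a
  combination of g and m = H g, so only the coefficient of m has to be matched. Convexity makes the
  Hessian positive semidefinite (\<open>convex_hess_nonneg\<close>), and then
  \<open>inner_matrix_of_square_eq_scaleR\<close> gives a (g . m) = m . m. Hence r = a, the ratio (m
  . g) / |m|^2 is 1/a, and the coefficient becomes 1 / (\<theta> (a + \<theta>)), as in the
  inverse.\<close>

text \<open>\<open>grad\<close> is a definite description, so it means something only once a
  gradient exists and is unique. Existence is the representation of the derivative \<open>D\<close>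
  as an inner product with \<open>adjoint D 1\<close>.\<close>

lemma GDERIV_grad:
  fixes f :: "real^'n \<Rightarrow> real"
  assumes "f differentiable (at x)"
  shows "GDERIV f x :> grad f x"
proof -
  obtain D where D: "(f has_derivative D) (at x)"
    using assms by (auto simp: differentiable_def)
  then have "linear D"
    by (rule has_derivative_linear)
  define d where "d = adjoint D 1"
  have "D = (\<lambda>h. h \<bullet> d)"
    using adjoint_works[OF \<open>linear D\<close>, of _ 1] by (simp add: d_def fun_eq_iff)
  with D have d: "GDERIV f x :> d"
    by (simp add: gderiv_def)
  moreover have "e = d" if "GDERIV f x :> e" for e
  proof -
    have "(\<lambda>h. h \<bullet> e) = (\<lambda>h. h \<bullet> d)"
      using that d has_derivative_unique unfolding gderiv_def by blast
    then show ?thesis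
      by (metis inner_commute vector_eq_ldot)
  qed
  ultimately show ?thesis
    unfolding grad_def by (rule theI)
qed

lemma has_derivative_grad_hess:
  assumes "grad f differentiable (at x)"
  shows "(grad f has_derivative (*v) (hess f x)) (at x)"
  using assms unfolding hess_def jacobian_works .

text \<open>Restricting to the line through \<open>x\<close> and \<open>y\<close> reduces this to
  the tangent inequality for a convex function of one real variable.\<close>

lemma convex_above_tangent_grad:
  fixes f :: "real^'n \<Rightarrow> real"
  assumes "convex_on UNIV f" "f differentiable (at x)"
  shows "f x + (y - x) \<bullet> grad f x \<le> f y"
proof -
  define \<phi> where "\<phi> t = f (x + t *\<^sub>R (y - x))" for t :: real
  have "convex_on UNIV \<phi>"
  proof (rule convex_onI)
    fix t u v :: real
    assume "0 < t" "t < 1"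
    moreover have "x + ((1 - t) *\<^sub>R u + t *\<^sub>R v) *\<^sub>R (y - x)
        = (1 - t) *\<^sub>R (x + u *\<^sub>R (y - x)) + t *\<^sub>R (x + v *\<^sub>R (y - x))"
      by (simp add: algebra_simps)
    ultimately show "\<phi> ((1 - t) *\<^sub>R u + t *\<^sub>R v) \<le> (1 - t) * \<phi> u + t * \<phi> v"
      using convex_onD[OF assms(1), of t "x + u *\<^sub>R (y - x)" "x + v *\<^sub>R (y - x)"]
      unfolding \<phi>_def by simp
  qed simp
  moreover have "(\<phi> has_real_derivative (y - x) \<bullet> grad f x) (at 0)"
  proof -
    have f: "(f has_derivative (\<lambda>h. h \<bullet> grad f x)) (at (x + 0 *\<^sub>R (y - x)))"
      using GDERIV_grad[OF assms(2)] by (simp add: gderiv_def)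
    have "((\<lambda>t. x + t *\<^sub>R (y - x)) has_derivative (\<lambda>t. t *\<^sub>R (y - x))) (at 0)"
      by (auto intro!: derivative_eq_intros)
    from has_derivative_compose[OF this f] show ?thesis
      unfolding \<phi>_def by (rule has_derivative_imp_has_field_derivative) simp
  qed
  ultimately have "(y - x) \<bullet> grad f x \<le> \<phi> 1 - \<phi> 0"
    using convex_on_imp_above_tangent[of UNIV \<phi> 0 1 "(y - x) \<bullet> grad f x"] by simp
  moreover have "\<phi> 0 = f x" "\<phi> 1 = f y"
    by (simp_all add: \<phi>_def)
  ultimately show ?thesis
    by linarith
qed

lemma convex_grad_monotone:
  fixes f :: "real^'n \<Rightarrow> real"
  assumes "convex_on UNIV f" "\<And>x. f differentiable (at x)"
  shows "0 \<le> (y - x) \<bullet> (grad f y - grad f x)"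
proof -
  have "f x + (y - x) \<bullet> grad f x \<le> f y" "f y + (x - y) \<bullet> grad f y \<le> f x"
    by (rule convex_above_tangent_grad[OF assms(1) assms(2)])+
  moreover have "(y - x) \<bullet> (grad f y - grad f x)
      = - ((x - y) \<bullet> grad f y) - (y - x) \<bullet> grad f x"
    by (simp add: inner_diff_left inner_diff_right)
  ultimately show ?thesis
    by linarith
qed

text \<open>The quadratic form at \<open>v\<close> is the slope at 0 of \<psi>, the component of the
  gradient along \<open>v\<close> on the line through \<open>x\<close>; \<psi> is monotone because
  the gradient is.\<close>

lemma convex_hess_nonneg:
  fixes f :: "real^'n \<Rightarrow> real"
  assumes "convex_on UNIV f" "twice_differentiable f"
  shows "0 \<le> v \<bullet> (hess f x *v v)"
proof -
  define \<psi> where "\<psi> t = v \<bullet> grad f (x + t *\<^sub>R v)" for t :: real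
  have "(grad f has_derivative (*v) (hess f x)) (at (x + 0 *\<^sub>R v))"
    using assms(2) by (simp add: twice_differentiable_def has_derivative_grad_hess)
  moreover have "((\<lambda>t. x + t *\<^sub>R v) has_derivative (\<lambda>t. t *\<^sub>R v)) (at 0)"
    by (auto intro!: derivative_eq_intros)
  ultimately have "((\<lambda>t. grad f (x + t *\<^sub>R v)) has_derivative
      (\<lambda>t. hess f x *v (t *\<^sub>R v))) (at 0)"
    using has_derivative_compose by blast
  from has_derivative_inner_right[OF this, of v]
  have "(\<psi> has_real_derivative v \<bullet> (hess f x *v v)) (at 0)"
    unfolding \<psi>_def
    by (rule has_derivative_imp_has_field_derivative) (simp add: matrix_vector_mult_scaleR)
  moreover have "mono \<psi>"
  proof (rule monoI)
    fix s t :: real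
    assume "s \<le> t"
    have "0 \<le> (t - s) * (\<psi> t - \<psi> s)"
      using convex_grad_monotone[OF assms(1), of "x + t *\<^sub>R v" "x + s *\<^sub>R v"] assms(2)
      by (simp add: twice_differentiable_def \<psi>_def inner_diff_right right_diff_distrib
          scaleR_left_diff_distrib[symmetric])
    with \<open>s \<le> t\<close> show "\<psi> s \<le> \<psi> t"
      by (cases "s = t") (auto simp: zero_le_mult_iff)
  qed
  ultimately show ?thesis
    by (intro mono_on_imp_deriv_nonneg[of UNIV \<psi> _ 0]) auto
qed

text \<open>Semidefiniteness makes the possibly oblique projection \<open>A / a\<close> orthogonal, so symmetry
  of \<open>A\<close> need not be known: \<open>u = a v - A v\<close> lies in the kernel of \<open>A\<close>, and testing
  the quadratic form on \<open>v + t u\<close> for all \<open>t\<close> gives \<open>u \<bullet> A v = 0\<close>.\<close>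

lemma inner_matrix_of_square_eq_scaleR:
  fixes A :: "real^'n^'n"
  assumes square: "A ** A = a *\<^sub>R A"
    and nonneg: "\<And>w. 0 \<le> w \<bullet> (A *v w)"
  shows "a * (v \<bullet> (A *v v)) = (A *v v) \<bullet> (A *v v)"
proof -
  define u where "u = a *\<^sub>R v - A *v v"
  have "A *v u = 0"
    by (simp add: u_def matrix_vector_mult_diff_distrib matrix_vector_mult_scaleR
        matrix_vector_mul_assoc square scaleR_matrix_vector_assoc)
  then have pos: "0 \<le> v \<bullet> (A *v v) + t * (u \<bullet> (A *v v))" for t
    using nonneg[of "v + t *\<^sub>R u"]
    by (simp add: matrix_vector_right_distrib matrix_vector_mult_scaleR inner_add_left)
  have "u \<bullet> (A *v v) = 0"
  proof (rule ccontr)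
    assume "u \<bullet> (A *v v) \<noteq> 0"
    \<comment> \<open>This choice of \<open>t\<close> gives the affine expression in
      \<open>pos\<close> the value -1.\<close>
    then show False
      using pos[of "- (v \<bullet> (A *v v) + 1) / (u \<bullet> (A *v v))"] by simp
  qed
  then show ?thesis
    by (simp add: u_def inner_diff_left)
qed

text \<open>For square matrices a one-sided inverse is two-sided and therefore unique, which
  identifies the choice made by \<open>matrix_inv\<close>.\<close>

lemma matrix_right_inverse_imp_inverse:
  fixes A B :: "real^'n^'n"
  assumes "A ** B = mat 1"
  shows "invertible A" "matrix_inv A = B"
proof -
  show "invertible A"
    using assms invertible_right_inverse by blast
  then have "matrix_inv A ** A = mat 1"
    unfolding invertible_def matrix_inv_def by (rule someI2_ex) blast
  then show "matrix_inv A = B"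
    by (metis assms matrix_mul_assoc matrix_mul_lid matrix_mul_rid)
qed

text \<open>Try (1/\<theta>) I - q A as inverse: the product with \<theta> I + A is I plus
  (1/\<theta> - q \<theta> - q a) A, which forces q = 1 / (\<theta> (a + \<theta>)).\<close>

lemma regularized_inverse_of_square_eq_scaleR:
  fixes A :: "real^'n^'n"
  assumes square: "A ** A = a *\<^sub>R A" and "\<theta> > 0" "a > 0"
  shows "invertible (\<theta> *\<^sub>R mat 1 + A)"
    and "matrix_inv (\<theta> *\<^sub>R mat 1 + A) *v v = (1 / \<theta>) *\<^sub>R v - (1 / (\<theta> * (a + \<theta>))) *\<^sub>R (A *v v)"
proof -
  define B where "B = (1 / \<theta>) *\<^sub>R mat 1 - (1 / (\<theta> * (a + \<theta>))) *\<^sub>R A"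
  \<comment> \<open>This is the coefficient of \<open>A\<close> left over in the product of \<theta>
    I + A with \<open>B\<close>.\<close>
  have coeff: "1 / \<theta> - 1 / (a + \<theta>) - a / (\<theta> * (a + \<theta>)) = 0"
    using assms(2,3) by (simp add: divide_simps)
  have B: "B *v w = (1 / \<theta>) *\<^sub>R w - (1 / (\<theta> * (a + \<theta>))) *\<^sub>R (A *v w)" for w
    by (simp add: B_def matrix_vector_mult_diff_rdistrib scaleR_matrix_vector_assoc[symmetric])
  have AA: "A *v (A *v w) = a *\<^sub>R (A *v w)" for w
    by (simp add: matrix_vector_mul_assoc square scaleR_matrix_vector_assoc)
  have "(\<theta> *\<^sub>R mat 1 + A) *v (B *v w) = w" for w
  proof -
    have "(\<theta> *\<^sub>R mat 1 + A) *v (B *v w)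
        = w + (1 / \<theta> - 1 / (a + \<theta>) - a / (\<theta> * (a + \<theta>))) *\<^sub>R (A *v w)"
      using assms(2,3)
      by (simp add: B matrix_vector_mult_add_rdistrib scaleR_matrix_vector_assoc[symmetric]
          AA matrix_vector_mult_diff_distrib matrix_vector_mult_scaleR
          scaleR_right_distrib scaleR_right_diff_distrib scaleR_left_diff_distrib)
    then show ?thesis
      by (simp only: coeff scaleR_zero_left add_0_right)
  qed
  then have "(\<theta> *\<^sub>R mat 1 + A) ** B = mat 1"
    by (simp add: matrix_eq matrix_vector_mul_assoc[symmetric])
  from matrix_right_inverse_imp_inverse[OF this]
  show "invertible (\<theta> *\<^sub>R mat 1 + A)"
    and "matrix_inv (\<theta> *\<^sub>R mat 1 + A) *v v = (1 / \<theta>) *\<^sub>R v - (1 / (\<theta> * (a + \<theta>))) *\<^sub>R (A *v v)"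
    by (simp_all add: B)
qed

theorem theorem3p1:
  fixes f :: "real^'n \<Rightarrow> real" and L :: real
    and x g m :: "nat \<Rightarrow> real^'n" and H :: "nat \<Rightarrow> real^'n^'n"
    and \<theta> r \<beta> \<mu> :: "nat \<Rightarrow> real"
  assumes L_pos: "L > 0"
    and f_convex: "convex_on UNIV f"
    and f_twice_diff: "twice_differentiable f"
    and grad_lipschitz: "\<exists>M. M-lipschitz_on UNIV (grad f)"
    and hess_lipschitz: "hess_lipschitz (2 * L) f"
    and g: "\<And>k. g k = grad f (x k)"
    and H: "\<And>k. H k = hess f (x k)"
    and m: "\<And>k. m k = H k *v g k"
    and \<theta>: "\<And>k. \<theta> k = sqrt (L * norm (g k))"
    and r: "\<And>k. r k = (g k \<bullet> ((H k ** H k) *v g k)) / (g k \<bullet> (H k *v g k))"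
    and \<beta>: "\<And>k. \<beta> k = 1 / \<theta> k"
    and \<mu>: "\<And>k. \<mu> k = 1 / (1 + \<theta> k / r k)"
    and aim: "aim_iterates f \<beta> \<mu> m x"
    and H_square: "\<And>k. \<exists>a>0. H k ** H k = a *\<^sub>R H k"
  shows "(\<forall>k. invertible (\<theta> k *\<^sub>R mat 1 + H k) \<and>
              x (Suc k) = x k - matrix_inv (\<theta> k *\<^sub>R mat 1 + H k) *v g k) \<and>
         (\<forall>y. y 0 = x 0 \<and> reg_newton_iterates L f y \<longrightarrow> y = x)"
proof -
  have step: "invertible (\<theta> k *\<^sub>R mat 1 + H k) \<and>
      x (Suc k) = x k - matrix_inv (\<theta> k *\<^sub>R mat 1 + H k) *v g k" for k
  proof -
    obtain a where a: "a > 0" "H k ** H k = a *\<^sub>R H k"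
      using H_square by blast
    have m0: "m k \<noteq> 0"
      and upd: "x (Suc k) = aim_step f (\<beta> k) (\<mu> k) (m k) (x k)"
      using aim by (auto simp: aim_iterates_def)
    \<comment> \<open>A nonzero inertial term excludes a stationary point, so the step size
      1/\<theta> is a genuine quotient.\<close>
    have "g k \<noteq> 0"
      using m0 by (auto simp: m)
    then have \<theta>_pos: "\<theta> k > 0"
      using L_pos by (simp add: \<theta>)
    have gm: "a * (g k \<bullet> m k) = m k \<bullet> m k"
      unfolding m by (rule inner_matrix_of_square_eq_scaleR[OF a(2)])
        (simp add: H convex_hess_nonneg f_convex f_twice_diff)
    \<comment> \<open>This inner product is the denominator of \<open>r k\<close>; being nonzero, it
      keeps \<open>r k\<close> from being the default value 0 of division by zero.\<close>
    with m0 have gm0: "g k \<bullet> m k \<noteq> 0"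
      by auto
    have "(H k ** H k) *v g k = a *\<^sub>R m k"
      by (simp add: a(2) m scaleR_matrix_vector_assoc)
    with gm0 have "r k = a"
      by (simp add: r m[symmetric])
    then have \<mu>': "\<mu> k = a / (a + \<theta> k)"
      using a(1) by (simp add: \<mu> divide_simps)
    have "(m k \<bullet> g k) / (norm (m k))\<^sup>2 = 1 / a"
      using gm gm0 a(1) m0 by (simp add: power2_norm_eq_inner inner_commute field_simps)
    then have "x (Suc k) = x k - (1 / \<theta> k) *\<^sub>R g k + (a / (a + \<theta> k) * (1 / a) * (1 / \<theta> k)) *\<^sub>R m k"
      by (simp only: upd aim_step_def Let_def g[symmetric] \<mu>' \<beta>)
    also have "a / (a + \<theta> k) * (1 / a) * (1 / \<theta> k) = 1 / (\<theta> k * (a + \<theta> k))"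
      using a(1) by simp
    finally show ?thesis
      using regularized_inverse_of_square_eq_scaleR[OF a(2) \<theta>_pos a(1)] by (simp add: m)
  qed
  moreover have "y = x" if y0: "y 0 = x 0" and y: "reg_newton_iterates L f y" for y
  proof
    fix k
    show "y k = x k"
    proof (induction k)
      case 0
      show ?case by (fact y0)
    next
      case (Suc k)
      then show ?case
        \<comment> \<open>At a common iterate, \<open>reg_newton_matrix\<close> is the matrix
          inverted in \<open>step\<close>, so both methods move to the same point.\<close>
        using y step[of k] by (simp add: reg_newton_iterates_def reg_newton_matrix_def \<theta> g H)
    qed
  qed
  ultimately show ?thesis
    by blast
qed

end
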